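(* Let $p>3$ be a prime, $m\in\mathbb{Z}_p$ and $m\not\equiv 1,-2,-\frac12\pmod p$. (i) If $p\equiv 1\pmod 3$, then $$\sum_{k=1}^{[p/3]}\binom{3k}{k}\frac{1}{(-3(m-1)(m+2))^k}\equiv\begin{cases}0\pmod p&\text{if }\big(\frac{m-1}{m+2}\big)^{\frac{p-1}{3}}\equiv 1\pmod p,\\[2mm]-\frac{3}{2m+1}\Big(m+1+\big(\frac{m-1}{m+2}\big)^{\frac{p-1}{3}}\Big)\pmod p&\text{if }\big(\frac{m-1}{m+2}\big)^{\frac{p-1}{3}}\not\equiv 1\pmod p.\end{cases}$$ (ii) If $p\equiv 2\pmod 3$, then $$\sum_{k=1}^{[p/3]}\binom{3k}{k}\frac{1}{(-3(m-1)(m+2))^k}\equiv \frac{1}{2m+1}\left\{(m-1)\Big(\frac{m-1}{m+2}\Big)^{\frac{p-2}{3}}+(m+2)\Big(\frac{m+2}{m-1}\Big)^{\frac{p-2}{3}}\right\}-1\pmod p.$$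
   Context: For a prime $p$, $\mathbb{Z}_p$ denotes the set of rational numbers whose denominator is not divisible by $p$; congruences modulo $p$ are taken in this ring. $[x]$ is the greatest integer not exceeding $x$. The expressions $\frac{m-1}{m+2}$ and $\frac{m+2}{m-1}$ are ordinary fractions (not Legendre symbols). *)

theory Defs
  imports Complex_Main "HOL-Number_Theory.Cong" "HOL-Computational_Algebra.Primes"
begin

(* Only rational p-integral numbers are meant here, not the p-adic integers.
   "quotient_of" returns the fraction in lowest terms. *)
definition p_integral :: "nat \<Rightarrow> rat set" where
  "p_integral p = {x. \<not> int p dvd snd (quotient_of x)}"

(* Congruence modulo p in the ring "p_integral p". The class-based "cong" and "dvd" are
   of no use on the field of rationals, where every nonzero p is a unit. *)
definition p_integral_cong :: "nat \<Rightarrow> rat \<Rightarrow> rat \<Rightarrow> bool" where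
  "p_integral_cong p a b \<longleftrightarrow>
     a \<in> p_integral p \<and> b \<in> p_integral p \<and> (\<exists>c \<in> p_integral p. a - b = of_nat p * c)"

end

theory Submission
  imports Defs "HOL-Number_Theory.Residues"
begin

text \<open>Put n = p div 3. Since p divides (3n + 1)(3n + 2), the coefficient C(3k,k) is congruent
  to (-27)^k C(n+k,2k) for k \<le> n, so the sum becomes a Morgan-Voyce polynomial
  \<Sum>k. C(n+k,2k) z^k at z = 9 / ((m-1)(m+2)). Writing a = m - 1 and b = m + 2, we have
  z = (b - a)^2 / (a b), for which the polynomial has the closed form
  (b (b/a)^n + a (a/b)^n) / (a + b). If p = 3n + 1, Fermat's theorem makes
  (a/b)^n a cube root of unity modulo p.\<close>

section \<open>Ring operations on \<open>p_integral p\<close> and its congruence modulo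
  \<open>p\<close>\<close>

text \<open>The lowest-terms denominator divides the denominator of every other representation, so
  any fraction with denominator prime to \<open>p\<close> will do. Closure properties can then be
  proved without normalising fractions.\<close>

lemma p_integral_iff:
  assumes "prime p"
  shows "x \<in> p_integral p \<longleftrightarrow> (\<exists>a b. \<not> int p dvd b \<and> x = of_int a / of_int b)"
proof
  assume "x \<in> p_integral p"
  then show "\<exists>a b. \<not> int p dvd b \<and> x = of_int a / of_int b"
    unfolding p_integral_def
    by (metis (mono_tags, lifting) mem_Collect_eq prod.collapse quotient_of_div)
next
  assume "\<exists>a b. \<not> int p dvd b \<and> x = of_int a / of_int b"
  then obtain a b where b: "\<not> int p dvd b" and x: "x = of_int a / of_int b" by blast
  obtain c d where q: "quotient_of x = (c, d)" by fastforce
  have d: "d > 0" and cop: "coprime c d"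
    using q quotient_of_denom_pos quotient_of_coprime by blast+
  have "b \<noteq> 0" using b by auto
  have "(of_int a :: rat) / of_int b = of_int c / of_int d"
    using x quotient_of_div[OF q] by simp
  then have "(of_int (a * d) :: rat) = of_int (c * b)"
    using d \<open>b \<noteq> 0\<close> by (simp add: field_simps)
  then have "a * d = c * b" by (simp only: of_int_eq_iff)
  then have "d dvd c * b" by (metis dvd_triv_right)
  then have "d dvd b" using cop coprime_commute coprime_dvd_mult_right_iff by blast
  then show "x \<in> p_integral p"
    using b q dvd_trans by (auto simp: p_integral_def)
qed

lemma p_integral_of_int [simp]:
  assumes "prime p"
  shows "of_int a \<in> p_integral p"
  using assms by (auto simp: p_integral_def prime_nat_iff)

lemma p_integral_numeral [simp]:
  assumes "prime p"
  shows "0 \<in> p_integral p" "1 \<in> p_integral p" "numeral k \<in> p_integral p" "of_nat n \<in> p_integral p"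
  using p_integral_of_int[OF assms, of 0] p_integral_of_int[OF assms, of 1]
    p_integral_of_int[OF assms, of "numeral k"] p_integral_of_int[OF assms, of "int n"]
  by simp_all

lemma p_integral_mult:
  assumes "prime p" "x \<in> p_integral p" "y \<in> p_integral p"
  shows "x * y \<in> p_integral p"
proof -
  obtain a b c d where "\<not> int p dvd b" "x = of_int a / of_int b"
      "\<not> int p dvd d" "y = of_int c / of_int d"
    using assms p_integral_iff by metis
  then have "\<not> int p dvd b * d" "x * y = of_int (a * c) / of_int (b * d)"
    using assms(1) by (auto simp: prime_dvd_mult_iff)
  then show ?thesis using p_integral_iff[OF assms(1)] by blast
qed

lemma p_integral_uminus:
  assumes "prime p" "x \<in> p_integral p"
  shows "- x \<in> p_integral p"
  using p_integral_mult[OF assms(1) p_integral_of_int[OF assms(1), of "-1"] assms(2)] by simp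

lemma p_integral_add:
  assumes "prime p" "x \<in> p_integral p" "y \<in> p_integral p"
  shows "x + y \<in> p_integral p"
proof -
  obtain a b c d where *: "\<not> int p dvd b" "x = of_int a / of_int b"
      "\<not> int p dvd d" "y = of_int c / of_int d"
    using assms p_integral_iff by metis
  then have "b \<noteq> 0" "d \<noteq> 0" by auto
  with * have "\<not> int p dvd b * d" "x + y = of_int (a * d + c * b) / of_int (b * d)"
    using assms(1) by (auto simp: prime_dvd_mult_iff field_simps)
  then show ?thesis using p_integral_iff[OF assms(1)] by blast
qed

lemma p_integral_diff:
  assumes "prime p" "x \<in> p_integral p" "y \<in> p_integral p"
  shows "x - y \<in> p_integral p"
  using p_integral_add[OF assms(1,2) p_integral_uminus[OF assms(1,3)]] by simp

lemma p_integral_power: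
  assumes "prime p" "x \<in> p_integral p"
  shows "x ^ k \<in> p_integral p"
  using assms by (induction k) (auto intro: p_integral_mult)

lemma p_integral_sum:
  assumes "prime p" "\<And>k. k \<in> A \<Longrightarrow> f k \<in> p_integral p"
  shows "sum f A \<in> p_integral p"
  using assms(2) by (induction A rule: infinite_finite_induct) (auto intro: p_integral_add assms(1) simp: assms(1))

lemmas p_integral_intros = p_integral_mult p_integral_uminus p_integral_add p_integral_diff
  p_integral_power p_integral_sum

text \<open>Integrality of \<open>a\<close> comes for free from
  \<open>a = b + p * c\<close>.\<close>

lemma p_integral_congI:
  assumes "prime p" "b \<in> p_integral p" "c \<in> p_integral p" "a - b = of_nat p * c"
  shows "p_integral_cong p a b"
proof -
  have "a = b + of_nat p * c" using assms(4) by (simp add: algebra_simps)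
  then have "a \<in> p_integral p"
    using assms(1-3) by (metis p_integral_add p_integral_mult p_integral_numeral(4))
  then show ?thesis using assms by (auto simp: p_integral_cong_def)
qed

lemma p_integral_congE:
  assumes "p_integral_cong p a b"
  obtains c where "c \<in> p_integral p" "a - b = of_nat p * c"
  using assms by (auto simp: p_integral_cong_def)

text \<open>Reduces a congruence to a ring identity: it suffices to write \<open>a - b\<close> as a
  \<open>p\<close>-integral multiple of a difference already known to vanish modulo
  \<open>p\<close>.\<close>

lemma p_integral_cong_scale:
  assumes "prime p" "p_integral_cong p x y" "u \<in> p_integral p" "b \<in> p_integral p"
    and "a - b = u * (x - y)"
  shows "p_integral_cong p a b"
proof -
  obtain c where "c \<in> p_integral p" "x - y = of_nat p * c"
    using assms(2) by (rule p_integral_congE)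
  then show ?thesis
    using assms by (intro p_integral_congI[of p b "u * c"]) (auto intro: p_integral_mult)
qed

lemma p_integral_cong_trans:
  assumes "prime p" "p_integral_cong p a b" "p_integral_cong p b c"
  shows "p_integral_cong p a c"
proof -
  obtain u where u: "u \<in> p_integral p" "a - b = of_nat p * u"
    using assms(2) by (rule p_integral_congE)
  obtain v where v: "v \<in> p_integral p" "b - c = of_nat p * v"
    using assms(3) by (rule p_integral_congE)
  have "a - c = of_nat p * (u + v)" using u v by (simp add: algebra_simps)
  moreover have "c \<in> p_integral p" using assms(3) by (simp add: p_integral_cong_def)
  ultimately show ?thesis
    using p_integral_congI[OF assms(1)] p_integral_add[OF assms(1) u(1) v(1)] by blast
qed

lemma p_integral_cong_of_int:
  assumes "prime p" "[a = b] (mod int p)"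
  shows "p_integral_cong p (of_int a) (of_int b)"
proof -
  obtain c where "a - b = int p * c" using assms(2) by (auto simp: cong_iff_dvd_diff)
  then have "(of_int a :: rat) - of_int b = of_nat p * of_int c"
    by (metis of_int_diff of_int_mult of_int_of_nat_eq)
  then show ?thesis using assms(1) by (intro p_integral_congI) auto
qed

lemma p_integral_cong_sum:
  assumes "prime p" "\<And>k. k \<in> A \<Longrightarrow> p_integral_cong p (f k) (g k)"
  shows "p_integral_cong p (sum f A) (sum g A)"
proof -
  have "\<forall>k\<in>A. \<exists>c \<in> p_integral p. f k - g k = of_nat p * c"
    using assms(2) by (auto simp: p_integral_cong_def)
  then obtain c where c: "\<And>k. k \<in> A \<Longrightarrow> c k \<in> p_integral p"
      "\<And>k. k \<in> A \<Longrightarrow> f k - g k = of_nat p * c k"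
    by metis
  have "sum f A - sum g A = of_nat p * sum c A"
    using c(2) by (simp add: sum_subtractf[symmetric] sum_distrib_left)
  moreover have "sum g A \<in> p_integral p"
    using assms by (intro p_integral_sum) (auto simp: p_integral_cong_def)
  ultimately show ?thesis
    using p_integral_sum[OF assms(1) c(1)] assms(1)
    by (intro p_integral_congI[of p _ "sum c A"]) simp_all
qed

text \<open>A numerator divisible by \<open>p\<close> would exhibit \<open>x\<close> as
  \<open>p\<close> times a \<open>p\<close>-integral number. Hence the elements not congruent to 0
  are exactly the units.\<close>

lemma p_integral_not_cong_0_fraction:
  assumes "prime p" "x \<in> p_integral p" "\<not> p_integral_cong p x 0"
  obtains a b where "\<not> int p dvd a" "\<not> int p dvd b" "x = of_int a / of_int b"
proof -
  obtain a b where b: "\<not> int p dvd b" and x: "x = of_int a / of_int b"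
    using assms p_integral_iff by metis
  have "\<not> int p dvd a"
  proof
    assume "int p dvd a"
    then obtain c where "a = int p * c" by blast
    then have "x - 0 = of_nat p * (of_int c / of_int b)" using x by simp
    moreover have "of_int c / of_int b \<in> p_integral p"
      using p_integral_iff[OF assms(1)] b by blast
    ultimately show False
      using p_integral_congI[OF assms(1) p_integral_numeral(1)[OF assms(1)]] assms(3) by blast
  qed
  then show ?thesis using that b x by blast
qed

lemma p_integral_inverse:
  assumes "prime p" "x \<in> p_integral p" "\<not> p_integral_cong p x 0"
  shows "inverse x \<in> p_integral p"
proof -
  obtain a b where "\<not> int p dvd a" "x = of_int a / of_int b"
    using p_integral_not_cong_0_fraction[OF assms] by metis
  then have "inverse x = of_int b / of_int a" by simp
  then show ?thesis using p_integral_iff[OF assms(1)] \<open>\<not> int p dvd a\<close> by blast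
qed

section \<open>Fermat's little theorem for integers and for \<open>p\<close>-integral
  rationals\<close>

lemma int_fermat_theorem:
  fixes a :: int
  assumes "prime p" "\<not> int p dvd a"
  shows "[a ^ (p - 1) = 1] (mod int p)"
proof -
  define r where "r = nat (a mod int p)"
  have r: "int r = a mod int p"
    using assms(1) prime_gt_0_nat[of p] by (simp add: r_def)
  then have "\<not> p dvd r" using assms(2) by (metis dvd_mod_iff dvd_refl int_dvd_int_iff)
  then have "[int (r ^ (p - 1)) = int 1] (mod int p)"
    using fermat_theorem[OF assms(1)] cong_int_iff by blast
  moreover have "[a ^ (p - 1) = int (r ^ (p - 1))] (mod int p)"
    by (simp add: cong_def r power_mod)
  ultimately show ?thesis using cong_trans by fastforce
qed

text \<open>Fermat's theorem applies to numerator and denominator separately; the resulting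
  congruence is then divided by the unit \<open>b ^ (p - 1)\<close>.\<close>

lemma p_integral_fermat:
  assumes "prime p" "x \<in> p_integral p" "\<not> p_integral_cong p x 0"
  shows "p_integral_cong p (x ^ (p - 1)) 1"
proof -
  obtain a b where ab: "\<not> int p dvd a" "\<not> int p dvd b" and x: "x = of_int a / of_int b"
    using p_integral_not_cong_0_fraction[OF assms] by metis
  have "[a ^ (p - 1) = b ^ (p - 1)] (mod int p)"
    using int_fermat_theorem[OF assms(1)] ab by (meson cong_sym cong_trans)
  then have *: "p_integral_cong p (of_int (a ^ (p - 1))) (of_int (b ^ (p - 1)))"
    using assms(1) p_integral_cong_of_int by blast
  have b: "\<not> int p dvd b ^ (p - 1)" 
    using ab(2) assms(1) prime_dvd_power[of "int p" b] by auto
  have "of_int 1 / of_int (b ^ (p - 1)) \<in> p_integral p"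
    using b p_integral_iff[OF assms(1)] by blast
  moreover have "b \<noteq> 0" using ab by auto
  ultimately show ?thesis
    unfolding x using assms(1)
    by (intro p_integral_cong_scale[OF _ *, of "of_int 1 / of_int (b ^ (p - 1))"])
       (auto simp: power_divide diff_divide_distrib)
qed

section \<open>Reduction of C(3k,k) to C(n+k,2k) modulo \<open>p\<close>\<close>

text \<open>C(n+k,2k) (2k)! is the product of the 2k consecutive integers from n-k+1 to n+k; raising
  k by one adds a factor at either end. For k at least n both sides vanish, so no bound on k is
  required.\<close>

lemma int_binomial_fact_Suc:
  "int ((n + Suc k) choose (2 * Suc k)) * fact (2 * Suc k) =
     int ((n + k) choose (2 * k)) * fact (2 * k) * ((int n - int k) * (int n + int k + 1))"
proof (cases "k < n")
  case True
  \<comment> \<open>With d = n - k - 1, the factorials (n-k)! and (n-k-1)! are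
    \<open>fact (Suc d)\<close> and \<open>fact d\<close>, and \<open>fact d\<close> can be
    cancelled at the end.\<close>
  then obtain d where d: "n = k + Suc d" using less_iff_Suc_add by auto
  have 1: "int ((n + k) choose (2 * k)) * fact (2 * k) * fact (Suc d) = (fact (n + k) :: int)"
    using arg_cong[OF binomial_fact_lemma[of "2 * k" "n + k"], of int] d
    by (simp add: mult_ac del: fact_Suc)
  have 2: "int ((n + Suc k) choose (2 * Suc k)) * fact (2 * Suc k) * fact d = (fact (n + Suc k) :: int)"
    using arg_cong[OF binomial_fact_lemma[of "2 * Suc k" "n + Suc k"], of int] d
    by (simp add: mult_ac del: fact_Suc binomial_Suc_Suc)
  have 3: "fact (n + Suc k) = fact (n + k) * (int n + int k + 1)"
    by (simp add: mult.commute add_ac)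
  have 4: "fact (Suc d) = (int n - int k) * fact d"
    by (simp add: d)
  have "int ((n + Suc k) choose (2 * Suc k)) * fact (2 * Suc k) * fact d =
     int ((n + k) choose (2 * k)) * fact (2 * k) * ((int n - int k) * (int n + int k + 1)) * fact d"
    unfolding 2 3 1[symmetric] 4 by (simp only: mult_ac)
  then show ?thesis by simp
next
  case False
  then show ?thesis by (cases "n = k") (simp_all add: binomial_eq_0)
qed

text \<open>Clearing the factorials from the denominators makes this an induction on k that never
  divides modulo \<open>q\<close>.\<close>

lemma binomial_3k_k_fact_cong:
  assumes "int q dvd (3 * int n + 1) * (3 * int n + 2)"
  shows "[(-27) ^ k * int ((n + k) choose (2 * k)) * fact (2 * k) * fact k = fact (3 * k)] (mod int q)"
proof (induction k)
  case 0
  then show ?case by simp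
next
  case (Suc k)
  \<comment> \<open>The terms in k cancel: the two products are 9k(k+1) - 9n(n+1) and 9k(k+1) +
    2.\<close>
  have "- 9 * (int n - int k) * (int n + int k + 1) - (3 * int k + 1) * (3 * int k + 2)
      = - ((3 * int n + 1) * (3 * int n + 2))"
    by (simp add: algebra_simps)
  then have "[- 9 * (int n - int k) * (int n + int k + 1) = (3 * int k + 1) * (3 * int k + 2)] (mod int q)"
    using assms by (simp only: cong_iff_dvd_diff dvd_minus_iff)
  \<comment> \<open>The last factor 3(k+1) turns -9 into -27 and \<open>fact k\<close> into
    \<open>fact (Suc k)\<close>, and on the right it completes (3k+3)!.\<close>
  from cong_mult[OF Suc cong_mult[OF this cong_refl[of "3 * int k + 3"]]]
  have "[((-27) ^ k * int ((n + k) choose (2 * k)) * fact (2 * k) * fact k) *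
      (- 9 * (int n - int k) * (int n + int k + 1) * (3 * int k + 3))
     = fact (3 * k) * ((3 * int k + 1) * (3 * int k + 2) * (3 * int k + 3))] (mod int q)" .
  moreover have "fact (3 * k) * ((3 * int k + 1) * (3 * int k + 2) * (3 * int k + 3)) = fact (3 * Suc k)"
    by (simp add: numeral_3_eq_3 algebra_simps)
  moreover have "((-27) ^ k * int ((n + k) choose (2 * k)) * fact (2 * k) * fact k) *
      (- 9 * (int n - int k) * (int n + int k + 1) * (3 * int k + 3))
     = (-27) ^ Suc k * (int ((n + Suc k) choose (2 * Suc k)) * fact (2 * Suc k)) * fact (Suc k)"
    unfolding int_binomial_fact_Suc by (simp add: algebra_simps)
  ultimately show ?case by (simp add: mult.assoc)
qed

text \<open>The common factor (2k)! k! can be cancelled because 2k < p makes it prime to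
  \<open>p\<close>.\<close>

lemma binomial_3k_k_cong:
  assumes "prime p" "p > 3" "k \<le> p div 3"
  shows "[int ((3 * k) choose k) = (-27) ^ k * int ((p div 3 + k) choose (2 * k))] (mod int p)"
proof -
  define n where "n = p div 3"
  have "p mod 3 \<noteq> 0"
    using assms(1,2) by (auto simp: prime_nat_iff mod_eq_0_iff_dvd)
  then have "p = 3 * n + 1 \<or> p = 3 * n + 2" unfolding n_def by presburger
  then have "int p = 3 * int n + 1 \<or> int p = 3 * int n + 2" by auto
  then have "int p dvd (3 * int n + 1) * (3 * int n + 2)" by auto
  note * = binomial_3k_k_fact_cong[OF this, of k]
  have "fact k * fact (3 * k - k) * ((3 * k) choose k) = (fact (3 * k) :: nat)"
    by (rule binomial_fact_lemma) simp
  moreover have "3 * k - k = 2 * k" by simp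
  ultimately have "fact k * fact (2 * k) * ((3 * k) choose k) = (fact (3 * k) :: nat)" by simp
  from arg_cong[OF this, of int]
  have "int ((3 * k) choose k) * (fact (2 * k) * fact k) = fact (3 * k)"
    by (simp add: mult_ac)
  with * have "[int ((3 * k) choose k) * (fact (2 * k) * fact k) =
      (-27) ^ k * int ((n + k) choose (2 * k)) * (fact (2 * k) * fact k)] (mod int p)"
    by (simp add: cong_sym_eq mult.assoc)
  moreover have "coprime (fact (2 * k) * fact k) (int p)"
  proof -
    have "2 * k < p" using assms by linarith
    then have "\<not> p dvd fact (2 * k)" "\<not> p dvd fact k"
      using assms(1) by (simp_all add: prime_dvd_fact_iff)
    then have "coprime (fact (2 * k) * fact k) p"
      using assms(1) by (metis coprime_commute coprime_mult_right_iff prime_imp_coprime)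
    then show ?thesis by (metis coprime_int_iff of_nat_fact of_nat_mult)
  qed
  ultimately show ?thesis unfolding n_def using cong_mult_rcancel by blast
qed

section \<open>Morgan-Voyce polynomials\<close>

lemma morgan_voyce_recurrence:
  fixes z :: "'a :: comm_ring_1"
  defines "F \<equiv> \<lambda>n. \<Sum>k\<le>n. of_nat ((n + k) choose (2 * k)) * z ^ k"
  shows "F (Suc (Suc n)) + F n = (z + 2) * F (Suc n)"
proof -
  \<comment> \<open>Since C(j+k,2k) = 0 for k > j, all three sums can be taken over one common
    range.\<close>
  have ext: "F j = (\<Sum>k\<le>Suc (Suc n). of_nat ((j + k) choose (2 * k)) * z ^ k)" if "j \<le> Suc (Suc n)" for j
    unfolding F_def using that by (intro sum.mono_neutral_left) (auto simp: binomial_eq_0)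
  \<comment> \<open>Pascal's rule applied twice: the second difference of C(N,r+2) in N is
    C(N,r).\<close>
  have coeff: "((Suc (Suc n) + Suc k) choose (2 * Suc k)) + ((n + Suc k) choose (2 * Suc k))
      = 2 * ((Suc n + Suc k) choose (2 * Suc k)) + ((Suc n + k) choose (2 * k))" for k
    by simp
  have shift: "z * F (Suc n) = (\<Sum>k\<le>Suc n. of_nat ((Suc n + k) choose (2 * k)) * z ^ Suc k)"
    unfolding F_def by (simp add: sum_distrib_left mult_ac del: sum.atMost_Suc binomial_Suc_Suc)
  have "F (Suc (Suc n)) + F n - 2 * F (Suc n) =
     (\<Sum>k\<le>Suc (Suc n). (of_nat ((Suc (Suc n) + k) choose (2 * k)) + of_nat ((n + k) choose (2 * k))
        - 2 * of_nat ((Suc n + k) choose (2 * k))) * z ^ k)"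
    by (simp add: ext sum.distrib[symmetric] sum_subtractf[symmetric] sum_distrib_left algebra_simps del: sum.atMost_Suc binomial_Suc_Suc)
  \<comment> \<open>The term at k = 0 is 1 + 1 - 2 = 0, so the index can be shifted.\<close>
  also have "\<dots> = (\<Sum>k\<le>Suc n. (of_nat ((Suc (Suc n) + Suc k) choose (2 * Suc k)) + of_nat ((n + Suc k) choose (2 * Suc k))
        - 2 * of_nat ((Suc n + Suc k) choose (2 * Suc k))) * z ^ Suc k)"
    by (subst sum.atMost_Suc_shift) (simp del: sum.atMost_Suc binomial_Suc_Suc)
  also have "\<dots> = (\<Sum>k\<le>Suc n. of_nat ((Suc n + k) choose (2 * k)) * z ^ Suc k)"
  proof (intro sum.cong refl)
    fix k
    have "(of_nat ((Suc (Suc n) + Suc k) choose (2 * Suc k)) + of_nat ((n + Suc k) choose (2 * Suc k)) :: 'a)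
      = 2 * of_nat ((Suc n + Suc k) choose (2 * Suc k)) + of_nat ((Suc n + k) choose (2 * k))"
      using arg_cong[OF coeff[of k], of "of_nat :: nat \<Rightarrow> 'a"] by (simp only: of_nat_add of_nat_mult of_nat_numeral)
    then show "(of_nat ((Suc (Suc n) + Suc k) choose (2 * Suc k)) + of_nat ((n + Suc k) choose (2 * Suc k))
        - 2 * of_nat ((Suc n + Suc k) choose (2 * Suc k))) * z ^ Suc k
      = of_nat ((Suc n + k) choose (2 * k)) * z ^ Suc k"
      by (simp del: binomial_Suc_Suc)
  qed
  finally show ?thesis unfolding shift[symmetric] by (simp only: algebra_simps)
qed

text \<open>With u = b/a and v = a/b, the factor z + 2 of the recurrence is u + v while uv = 1, so u
  and v are the characteristic roots. It remains to match the values at n = 0 and n = 1. Multiplying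
  by \<open>a + b\<close> allows that sum to be zero.\<close>

lemma morgan_voyce_closed_form:
  fixes a b :: "'a :: field"
  assumes "a \<noteq> 0" "b \<noteq> 0"
  shows "(a + b) * (\<Sum>k\<le>n. of_nat ((n + k) choose (2 * k)) * ((b - a)\<^sup>2 / (a * b)) ^ k) =
    b * (b / a) ^ n + a * (a / b) ^ n"
proof -
  define u v where "u = b / a" and "v = a / b"
  have uv: "a * u = b" "b * v = a" "u * v = 1"
    using assms by (simp_all add: u_def v_def)
  have "(u + v - 2) * (a * b) = (a * u) * b + a * (b * v) - 2 * (a * b)"
    by (simp add: algebra_simps)
  then have "(b - a)\<^sup>2 = (u + v - 2) * (a * b)"
    unfolding uv by (simp add: algebra_simps power2_eq_square)
  then have z: "(b - a)\<^sup>2 / (a * b) = u + v - 2"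
    using assms by simp
  show ?thesis
    unfolding z u_def[symmetric] v_def[symmetric]
  proof (induction n rule: induct_nat_012)
    case 0
    then show ?case by (simp add: algebra_simps)
  next
    case 1
    have "(a + b) * (1 + (u + v - 2)) = a * u + b * v - a - b + (b * u + a * v)"
      by (simp add: algebra_simps)
    also have "\<dots> = b * u + a * v"
      by (simp add: uv(1,2))
    finally show ?case by (simp add: numeral_2_eq_2)
  next
    case (ge2 n)
    let ?F = "\<lambda>n. \<Sum>k\<le>n. of_nat ((n + k) choose (2 * k)) * (u + v - 2) ^ k"
    have "?F (Suc (Suc n)) + ?F n = (u + v) * ?F (Suc n)"
      using morgan_voyce_recurrence[of n "u + v - 2"] by (simp only: diff_add_cancel)
    then have "(a + b) * ?F (Suc (Suc n)) = (u + v) * ((a + b) * ?F (Suc n)) - (a + b) * ?F n"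
      by (simp only: eq_diff_eq distrib_left[symmetric] mult.left_commute[of "u + v"])
    also have "\<dots> = (u + v) * (b * u ^ Suc n + a * v ^ Suc n) - (b * u ^ n + a * v ^ n)"
      by (simp only: ge2)
    also have "\<dots> = b * u ^ Suc (Suc n) + a * v ^ Suc (Suc n) + (u * v - 1) * (b * u ^ n + a * v ^ n)"
      by (simp add: algebra_simps)
    also have "\<dots> = b * u ^ Suc (Suc n) + a * v ^ Suc (Suc n)"
      by (simp add: uv(3))
    finally show ?case .
  qed
qed

section \<open>Evaluation of the sum modulo \<open>p\<close>\<close>

text \<open>Serves both residue classes of \<open>p\<close> modulo 3, the exponent being
  \<open>p div 3\<close> in each. It is already case (ii); case (i) simplifies the right-hand side
  further.\<close>

lemma sum_binomial_3k_k_cong: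
  assumes "prime p" "p > 3" "m \<in> p_integral p"
    and "\<not> p_integral_cong p (m - 1) 0" "\<not> p_integral_cong p (m + 2) 0" "2 * m + 1 \<noteq> 0"
  shows "p_integral_cong p
    (\<Sum>k = 1..p div 3. of_nat ((3 * k) choose k) * (1 / (- 3 * (m - 1) * (m + 2)) ^ k))
    (1 / (2 * m + 1) * ((m - 1) * ((m - 1) / (m + 2)) ^ (p div 3)
       + (m + 2) * ((m + 2) / (m - 1)) ^ (p div 3)) - 1)"
proof -
  define n where "n = p div 3"
  define y where "y = 1 / (- 3 * (m - 1) * (m + 2))"
  have nz: "m - 1 \<noteq> 0" "m + 2 \<noteq> 0"
    using assms p_integral_congI[of p 0 0] by auto
  have "\<not> int p dvd - 3" using assms(2) by (auto dest: zdvd_imp_le)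
  then have "of_int 1 / of_int (- 3) \<in> p_integral p"
    using p_integral_iff[OF assms(1)] by blast
  moreover have "inverse (m - 1) \<in> p_integral p" "inverse (m + 2) \<in> p_integral p"
    using assms by (auto intro!: p_integral_inverse p_integral_intros)
  ultimately have "of_int 1 / of_int (- 3) * inverse (m - 1) * inverse (m + 2) \<in> p_integral p"
    using assms(1) by (blast intro: p_integral_mult)
  also have "of_int 1 / of_int (- 3) * inverse (m - 1) * inverse (m + 2) = y"
    by (simp only: y_def divide_inverse inverse_mult_distrib of_int_minus of_int_numeral of_int_1 mult_1)
  finally have y: "y \<in> p_integral p" .
  have "p_integral_cong p (\<Sum>k = 1..n. of_nat ((3 * k) choose k) * y ^ k)
      (\<Sum>k = 1..n. of_int ((- 27) ^ k * int ((n + k) choose (2 * k))) * y ^ k)"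
  proof (rule p_integral_cong_sum[OF assms(1)])
    fix k assume "k \<in> {1..n}"
    then have "[int ((3 * k) choose k) = (-27) ^ k * int ((n + k) choose (2 * k))] (mod int p)"
      using binomial_3k_k_cong[OF assms(1,2)] unfolding n_def by simp
    from p_integral_cong_of_int[OF assms(1) this]
    show "p_integral_cong p (of_nat ((3 * k) choose k) * y ^ k)
       (of_int ((- 27) ^ k * int ((n + k) choose (2 * k))) * y ^ k)"
      by (rule p_integral_cong_scale[OF assms(1), where u = "y ^ k"])
         (use y assms(1) in \<open>auto intro!: p_integral_intros simp: algebra_simps\<close>)
  qed
  also have "(\<Sum>k = 1..n. of_nat ((3 * k) choose k) * y ^ k) =
      (\<Sum>k = 1..n. of_nat ((3 * k) choose k) * (1 / (- 3 * (m - 1) * (m + 2)) ^ k))"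
    by (simp only: y_def power_one_over)
  also have "(\<Sum>k = 1..n. of_int ((- 27) ^ k * int ((n + k) choose (2 * k))) * y ^ k) =
     (\<Sum>k = 1..n. of_nat ((n + k) choose (2 * k)) * (-27 * y) ^ k)"
    by (simp only: power_mult_distrib mult_ac of_int_mult of_int_power of_int_minus
        of_int_numeral of_int_of_nat_eq)
  also have "-27 * y = ((m + 2) - (m - 1))\<^sup>2 / ((m - 1) * (m + 2))"
  proof -
    \<comment> \<open>Valid for zero \<open>a\<close> or \<open>b\<close> as well, both sides then
      being 0. The 3 that is squared is (m+2) - (m-1).\<close>
    have "-27 * (1 / (- 3 * a * b)) = 3\<^sup>2 / (a * b)" for a b :: rat by simp
    then show ?thesis by (simp only: y_def) simp
  qed
  \<comment> \<open>The subtracted 1 is the term at k = 0, which the closed form includes.\<close>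
  also have "(\<Sum>k = 1..n. of_nat ((n + k) choose (2 * k)) * (((m + 2) - (m - 1))\<^sup>2 / ((m - 1) * (m + 2))) ^ k) =
     (\<Sum>k\<le>n. of_nat ((n + k) choose (2 * k)) * (((m + 2) - (m - 1))\<^sup>2 / ((m - 1) * (m + 2))) ^ k) - 1"
    by (simp add: atMost_atLeast0 sum.atLeast_Suc_atMost)
  also have "(\<Sum>k\<le>n. of_nat ((n + k) choose (2 * k)) * (((m + 2) - (m - 1))\<^sup>2 / ((m - 1) * (m + 2))) ^ k)
     = 1 / (2 * m + 1) * ((m - 1) * ((m - 1) / (m + 2)) ^ n + (m + 2) * ((m + 2) / (m - 1)) ^ n)"
    (is "?S = _")
  proof -
    have c: "(m - 1) + (m + 2) = 2 * m + 1" by simp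
    have "?S = 1 / (2 * m + 1) * ((2 * m + 1) * ?S)" using assms(6) by simp
    also note morgan_voyce_closed_form[OF nz, of n, unfolded c]
    finally show ?thesis by (simp only: add.commute)
  qed
  finally show ?thesis unfolding n_def .
qed

theorem theorem2p4:
  fixes p :: nat and m :: rat
  assumes "prime p" and "p > 3"
    and "m \<in> p_integral p"
    and "\<not> p_integral_cong p m 1"
    and "\<not> p_integral_cong p m (- 2)"
    and "\<not> p_integral_cong p m (- (1 / 2))"
  shows
    "([p = 1] (mod 3) \<longrightarrow>
        p_integral_cong p
          (\<Sum>k = 1..p div 3. of_nat ((3 * k) choose k) * (1 / (- 3 * (m - 1) * (m + 2)) ^ k))
          (if p_integral_cong p (((m - 1) / (m + 2)) ^ ((p - 1) div 3)) 1
           then 0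
           else - (3 / (2 * m + 1)) * (m + 1 + ((m - 1) / (m + 2)) ^ ((p - 1) div 3))))
     \<and>
     ([p = 2] (mod 3) \<longrightarrow>
        p_integral_cong p
          (\<Sum>k = 1..p div 3. of_nat ((3 * k) choose k) * (1 / (- 3 * (m - 1) * (m + 2)) ^ k))
          (1 / (2 * m + 1) *
             ((m - 1) * ((m - 1) / (m + 2)) ^ ((p - 2) div 3)
              + (m + 2) * ((m + 2) / (m - 1)) ^ ((p - 2) div 3)) - 1))"
proof -
  \<comment> \<open>The three excluded residues of \<open>m\<close> make \<open>m - 1\<close>,
    \<open>m + 2\<close> and their sum \<open>2 * m + 1\<close> units.\<close>
  have a_ne: "\<not> p_integral_cong p (m - 1) 0"
    using assms(4) p_integral_cong_scale[OF assms(1), of "m - 1" 0 1 1 m] assms(1) by auto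
  have b_ne: "\<not> p_integral_cong p (m + 2) 0"
    using assms(5) p_integral_cong_scale[OF assms(1), of "m + 2" 0 1 "- 2" m]
      p_integral_uminus[OF assms(1), of 2] assms(1) by auto
  have "\<not> int p dvd 2" using assms(2) by (auto dest: zdvd_imp_le)
  then have "of_int 1 / of_int 2 \<in> p_integral p"
    using p_integral_iff[OF assms(1)] by blast
  then have half: "1 / 2 \<in> p_integral p" by simp
  have c_ne: "\<not> p_integral_cong p (2 * m + 1) 0"
    using assms(6) p_integral_cong_scale[OF assms(1), of "2 * m + 1" 0 "1 / 2" "- (1 / 2)" m]
      half p_integral_uminus[OF assms(1) half] by auto
  have nz: "m - 1 \<noteq> 0" "m + 2 \<noteq> 0" "2 * m + 1 \<noteq> 0"
    using a_ne b_ne c_ne p_integral_congI[OF assms(1), of 0 0 0] assms(1) by auto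
  have int: "m - 1 \<in> p_integral p" "m + 2 \<in> p_integral p" "2 * m + 1 \<in> p_integral p"
    using assms by (auto intro!: p_integral_intros)
  have inv: "inverse (m - 1) \<in> p_integral p" "inverse (m + 2) \<in> p_integral p"
      "inverse (2 * m + 1) \<in> p_integral p"
    by (fact p_integral_inverse[OF assms(1) int(1) a_ne] p_integral_inverse[OF assms(1) int(2) b_ne]
        p_integral_inverse[OF assms(1) int(3) c_ne])+
  note S = sum_binomial_3k_k_cong[OF assms(1-3) a_ne b_ne nz(3)]
  show ?thesis
  proof (intro conjI impI)
    assume "[p = 2] (mod 3)"
    then have "p - 2 = p div 3 * 3"
      using minus_mod_eq_div_mult[of p 3] by (simp add: cong_def)
    then have "(p - 2) div 3 = p div 3" by simp
    then show "p_integral_cong p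
          (\<Sum>k = 1..p div 3. of_nat ((3 * k) choose k) * (1 / (- 3 * (m - 1) * (m + 2)) ^ k))
          (1 / (2 * m + 1) *
             ((m - 1) * ((m - 1) / (m + 2)) ^ ((p - 2) div 3)
              + (m + 2) * ((m + 2) / (m - 1)) ^ ((p - 2) div 3)) - 1)"
      using S by (simp only:)
  next
    assume p1: "[p = 1] (mod 3)"
    define n where "n = p div 3"
    define w where "w = ((m - 1) / (m + 2)) ^ n"
    have n: "p - 1 = n * 3"
      using p1 minus_mod_eq_div_mult[of p 3] by (simp add: cong_def n_def)
    then have n_div: "(p - 1) div 3 = n" by simp
    have w_inv: "((m + 2) / (m - 1)) ^ n = inverse w"
      by (simp add: w_def power_inverse[symmetric])
    have q: "(m - 1) / (m + 2) \<in> p_integral p" "(m + 2) / (m - 1) \<in> p_integral p"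
      using int inv assms(1) by (auto simp: divide_inverse intro: p_integral_mult)
    have w: "w \<in> p_integral p" "inverse w \<in> p_integral p" "w \<noteq> 0"
      using q assms(1) nz unfolding w_inv[symmetric] by (auto simp: w_def intro: p_integral_power)
    have "\<not> p_integral_cong p ((m - 1) / (m + 2)) 0"
      using a_ne p_integral_cong_scale[OF assms(1) _ int(2), of "(m - 1) / (m + 2)" 0 0 "m - 1"] nz assms(1)
      by auto
    from p_integral_fermat[OF assms(1) q(1) this]
    \<comment> \<open>As p - 1 = 3n, the cube of \<open>w\<close> is the (p-1)-th power of
      (m-1)/(m+2).\<close>
    have w3: "p_integral_cong p (w ^ 3) 1" by (simp only: n power_mult w_def)
    \<comment> \<open>Treating the inverses as plain variables turns the identities below into
      polynomial ones: multiples of \<open>i * (2 * m + 1) - 1\<close> and \<open>v * w - 1\<close>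
      are added explicitly and then vanish by \<open>iv\<close>.\<close>
    define i v where "i = inverse (2 * m + 1)" and "v = inverse w"
    have iv: "i * (2 * m + 1) = 1" "v * w = 1" using nz w by (simp_all add: i_def v_def)
    have i: "1 / (2 * m + 1) = i" by (simp add: i_def inverse_eq_divide)
    have iv_int: "i \<in> p_integral p" "v \<in> p_integral p" using inv w by (simp_all add: i_def v_def)
    have "p_integral_cong p
        (1 / (2 * m + 1) * ((m - 1) * w + (m + 2) * inverse w) - 1)
        (if p_integral_cong p w 1 then 0 else - (3 / (2 * m + 1)) * (m + 1 + w))"
    proof (cases "p_integral_cong p w 1")
      case True
      \<comment> \<open>At w = 1 the bracket is (m-1) + (m+2) = 2m+1, so the whole expression has
        the factor \<open>w - 1\<close>.\<close>
      have "i * ((m - 1) * w + (m + 2) * v) - 1 - 0 = i * ((m - 1) - (m + 2) * v) * (w - 1)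
          + (i * (2 * m + 1) - 1) + i * (m + 2) * (v * w - 1)"
        by (simp add: algebra_simps)
      then have "i * ((m - 1) * w + (m + 2) * v) - 1 - 0 = i * ((m - 1) - (m + 2) * v) * (w - 1)"
        by (simp only: iv) simp
      moreover have "i * ((m - 1) - (m + 2) * v) \<in> p_integral p"
        using assms(1) iv_int int by (blast intro: p_integral_mult p_integral_diff)
      ultimately have "p_integral_cong p (i * ((m - 1) * w + (m + 2) * v) - 1) 0"
        using p_integral_cong_scale[OF assms(1) True] assms(1) by simp
      then show ?thesis using True by (simp add: i v_def)
    next
      case False
      then have "\<not> p_integral_cong p (w - 1) 0"
        using p_integral_cong_scale[OF assms(1), of "w - 1" 0 1 1 w] assms(1) by auto
      then have "inverse (w - 1) \<in> p_integral p"
        using p_integral_inverse[OF assms(1) p_integral_diff[OF assms(1) w(1)]] assms(1) by simp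
      have "w - 1 \<noteq> 0"
        using False p_integral_congI[OF assms(1), of 1 0 1] assms(1) by auto
      have cube: "w ^ 3 - 1 = (w - 1) * (w\<^sup>2 + w + 1)"
        by (simp add: algebra_simps power2_eq_square power3_eq_cube)
      \<comment> \<open>Here \<open>w - 1\<close> is a unit and can be cancelled from the factored
        congruence \<open>w3\<close>.\<close>
      have "p_integral_cong p (w\<^sup>2 + w + 1) 0"
        by (rule p_integral_cong_scale[OF assms(1) w3 \<open>inverse (w - 1) \<in> p_integral p\<close>])
           (use assms(1) \<open>w - 1 \<noteq> 0\<close> in \<open>simp_all add: cube\<close>)
      \<comment> \<open>Modulo w^2 + w + 1 the inverse \<open>v\<close> is -(w+1), so (m-1)w +
        (m+2)v - (2m+1) becomes -3(m+1+w).\<close>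
      moreover have "i * ((m - 1) * w + (m + 2) * v) - 1 - - (3 * i) * (m + 1 + w)
          = (m + 2) * v * i * (w\<^sup>2 + w + 1 - 0)"
      proof -
        have "i * ((m - 1) * w + (m + 2) * v) - 1 - - (3 * i) * (m + 1 + w)
            = (m + 2) * v * i * (w\<^sup>2 + w + 1 - 0)
              + (i * (2 * m + 1) - 1) - i * (m + 2) * (w + 1) * (v * w - 1)"
          by (simp add: algebra_simps power2_eq_square)
        then show ?thesis by (simp only: iv) simp
      qed
      moreover have "(m + 2) * v * i \<in> p_integral p" "- (3 * i) * (m + 1 + w) \<in> p_integral p"
        using assms(1,3) w(1) iv_int int by (auto intro!: p_integral_intros)
      ultimately have "p_integral_cong p (i * ((m - 1) * w + (m + 2) * v) - 1)
          (- (3 * i) * (m + 1 + w))"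
        using p_integral_cong_scale[OF assms(1)] by blast
      then show ?thesis using False by (simp add: v_def i_def divide_inverse)
    qed
    from p_integral_cong_trans[OF assms(1) S[folded n_def, unfolded w_inv, folded w_def] this]
    show "p_integral_cong p
          (\<Sum>k = 1..p div 3. of_nat ((3 * k) choose k) * (1 / (- 3 * (m - 1) * (m + 2)) ^ k))
          (if p_integral_cong p (((m - 1) / (m + 2)) ^ ((p - 1) div 3)) 1
           then 0
           else - (3 / (2 * m + 1)) * (m + 1 + ((m - 1) / (m + 2)) ^ ((p - 1) div 3)))"
      unfolding n_div w_def n_def .
  qed
qed

end
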